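(* Let $d\ge1$ be an integer, let $(X_\varepsilon)_{\varepsilon>0}$ be a family of random vectors and $X$ a random vector, all defined on a probability space $(\Omega,\mathcal{F},\mathbb{P})$ and taking values in $(\mathbb{R}^d,\mathcal{B}(\mathbb{R}^d))$. Let $\varphi_\varepsilon$ and $\varphi$ denote the characteristic functions of $X_\varepsilon$ and $X$, respectively. Assume that: (i) $X_\varepsilon\to X$ in distribution as $\varepsilon\to0^+$; (ii) $\varphi\in L^1(\mathbb{R}^d)$ and $\varphi_\varepsilon\in L^1(\mathbb{R}^d)$ for each $\varepsilon>0$; (iii) $\displaystyle\limsup_{\ell\to\infty}\limsup_{\varepsilon\to0^+}\int_{\{|z|\ge\ell\}}|\varphi_\varepsilon(z)|\,\mathrm{d}z=0.$ Then $$\lim_{\varepsilon\to0^+}\mathrm{d}_{\mathrm{TV}}(X_\varepsilon,X)=0.$$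
   Context: The total variation distance between probability measures $\nu_1,\nu_2$ on $\mathbb{R}^d$ is $\mathrm{d}_{\mathrm{TV}}(\nu_1,\nu_2)=\inf_{\Pi}\Pi(\{(u,v):u\ne v\})$, the infimum over all couplings $\Pi$ of $\nu_1$ and $\nu_2$; $\mathrm{d}_{\mathrm{TV}}(X_\varepsilon,X)$ denotes the distance between the laws of $X_\varepsilon$ and $X$. The characteristic function of a random vector $X$ is $z\mapsto\mathbb{E}[e^{\mathsf{i}\langle z,X\rangle}]$; $|z|$ is the Euclidean norm of $z\in\mathbb{R}^d$. *)

theory Defs
  imports "HOL-Probability.Probability"
begin

definition couplings :: "'a measure \<Rightarrow> 'a measure \<Rightarrow> ('a \<times> 'a) measure set" where
  "couplings \<mu> \<nu> = {P. prob_space P \<and> sets P = sets (\<mu> \<Otimes>\<^sub>M \<nu>) \<and>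
     distr P \<mu> fst = \<mu> \<and> distr P \<nu> snd = \<nu>}"

(* For probability measures the infimum is over a nonempty set (it contains the product measure)
   and is bounded below by 0. The off-diagonal set is measurable for Borel measures on a
   second-countable Hausdorff space. *)
definition tv_dist :: "'a measure \<Rightarrow> 'a measure \<Rightarrow> real" where
  "tv_dist \<mu> \<nu> = (INF P\<in>couplings \<mu> \<nu>. measure P {(u, v). u \<noteq> v})"

(* The library's char and weak_conv_m only cover measures on the real line. *)
definition char_fun :: "'w measure \<Rightarrow> ('w \<Rightarrow> 'a::euclidean_space) \<Rightarrow> 'a \<Rightarrow> complex" where
  "char_fun M X z = (LINT \<omega>|M. exp (\<i> * complex_of_real (z \<bullet> X \<omega>)))"

definition converges_in_distribution ::
  "'w measure \<Rightarrow> ('i \<Rightarrow> 'w \<Rightarrow> 'a::topological_space) \<Rightarrow> ('w \<Rightarrow> 'a) \<Rightarrow> 'i filter \<Rightarrow> bool" where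
  "converges_in_distribution M X Y F \<longleftrightarrow>
     (\<forall>f :: 'a \<Rightarrow> real. continuous_on UNIV f \<and> bounded (range f) \<longrightarrow>
        ((\<lambda>i. LINT \<omega>|M. f (X i \<omega>)) \<longlongrightarrow> (LINT \<omega>|M. f (Y \<omega>))) F)"

end

(* An integrable characteristic function yields, by Fourier inversion, a density; the inversion
   formula is obtained by smoothing with a small Gaussian vector. Convergence in distribution gives
   pointwise convergence of the characteristic functions, and the tail condition upgrades it to L^1
   convergence, so that the densities converge pointwise (even uniformly). The total variation
   distance is at most the integral of the positive part of (f - f_eps), because the mass min(f, f_eps)
   can be coupled on the diagonal; this integrand is dominated by the limit density f, so the integral
   tends to 0. *)

theory Submission
  imports Defs
begin

subsection \<open>The Gaussian kernel and its Fourier transform\<close>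

text \<open>Inversion cannot be checked by exchanging integrals directly: the function z \<mapsto>
  exp(i<z, X - x>) has modulus 1 and is not integrable over the whole space. A Gaussian factor in z
  restores integrability. After the exchange it turns into an average of Gaussian densities centred
  at the values of X, and this is where nonnegativity of the density comes from, which the Fourier
  formula does not show. The Gaussian is convenient because it is its own Fourier transform up to a
  factor; every constant is therefore written through \<open>std_gauss 0\<close>, and no power of 2
  pi is evaluated. The obstacle to L^1 convergence of the characteristic functions is that their
  only common bound is 1, which is integrable on balls but not globally. In the last step no common
  bound on the f_eps is available either. This does no harm: both densities have mass 1, so the
  positive parts of f - f_eps and f_eps - f have the same integral, and the convenient one may be
  used.\<close>

definition std_gauss :: "'a::euclidean_space \<Rightarrow> real" where
  "std_gauss x = (\<Prod>b\<in>Basis. std_normal_density (x \<bullet> b))"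

text \<open>The product form suits Fubini, the radial form suits bounds and continuity. The value at
  0 serves as an unevaluated normalising constant.\<close>

lemma std_gauss_eq:
  "std_gauss (x::'a::euclidean_space) = std_gauss (0::'a) * exp (- (norm x)\<^sup>2 / 2)"
proof -
  have "std_gauss x = (\<Prod>b\<in>Basis. std_normal_density 0 * exp (- (x \<bullet> b)\<^sup>2 / 2))"
    by (simp add: std_gauss_def std_normal_density_def)
  also have "\<dots> = std_gauss (0::'a) * (\<Prod>b\<in>Basis. exp (- (x \<bullet> b)\<^sup>2 / 2))"
    by (simp add: prod.distrib std_gauss_def)
  also have "(\<Prod>b\<in>Basis. exp (- (x \<bullet> b)\<^sup>2 / 2)) = exp (\<Sum>b\<in>Basis. - (x \<bullet> b)\<^sup>2 / 2)"
    by (simp add: exp_sum)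
  also have "(\<Sum>b\<in>Basis. - (x \<bullet> b)\<^sup>2 / 2) = - (norm x)\<^sup>2 / 2"
    by (simp add: norm_eq_sqrt_inner euclidean_inner[of x x] power2_eq_square sum_negf
        sum_divide_distrib sum_nonneg)
  finally show ?thesis .
qed

lemma std_gauss_pos: "0 < std_gauss x"
  by (auto simp: std_gauss_def intro!: prod_pos normal_density_pos)

lemma std_gauss_nonneg [simp]: "0 \<le> std_gauss x"
  using std_gauss_pos[of x] by simp

lemma std_gauss_le: "std_gauss (x::'a::euclidean_space) \<le> std_gauss (0::'a)"
  using std_gauss_nonneg[of "0::'a"] by (subst std_gauss_eq) (simp add: mult_left_le)

lemma continuous_on_std_gauss [continuous_intros]:
  "continuous_on S f \<Longrightarrow> continuous_on S (\<lambda>x. std_gauss (f x))"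
  by (subst std_gauss_eq) (intro continuous_intros; simp)

lemma borel_measurable_std_gauss [measurable]: "std_gauss \<in> borel_measurable borel"
  by (intro borel_measurable_continuous_onI continuous_intros)

text \<open>Lebesgue measure is the image of the product of one-dimensional Lebesgue measures under
  the coordinate map (\<open>lborel_eq\<close>), so both claims reduce to Fubini for finite
  products.\<close>

lemma
  fixes g :: "'a::euclidean_space \<Rightarrow> real \<Rightarrow> complex"
  assumes g: "\<And>b. b \<in> Basis \<Longrightarrow> integrable lborel (g b)"
  shows integrable_lborel_prod: "integrable lborel (\<lambda>x. \<Prod>b\<in>Basis. g b (x \<bullet> b))"
    and integral_lborel_prod:
      "(LINT x|lborel. (\<Prod>b\<in>Basis. g b (x \<bullet> b))) = (\<Prod>b\<in>Basis. (LINT x|lborel. g b x))"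
proof -
  interpret product_sigma_finite "\<lambda>_::'a. lborel :: real measure" ..
  have [measurable]: "g b \<in> borel_measurable borel" if "b \<in> Basis" for b
    using g[OF that] by simp
  have T [measurable]: "(\<lambda>f. \<Sum>b\<in>Basis. f b *\<^sub>R b) \<in> (\<Pi>\<^sub>M b\<in>Basis. lborel) \<rightarrow>\<^sub>M (borel :: 'a measure)"
    by measurable
  have *: "(\<Prod>b\<in>Basis. g b ((\<Sum>b\<in>Basis. f b *\<^sub>R b) \<bullet> b)) = (\<Prod>b\<in>Basis. g b (f b))" for f
    by simp
  show "integrable lborel (\<lambda>x. \<Prod>b\<in>Basis. g b (x \<bullet> b))"
    by (subst lborel_eq, subst integrable_distr_eq)
      (auto simp: intro!: product_integrable_prod g borel_measurable_prod)
  show "(LINT x|lborel. (\<Prod>b\<in>Basis. g b (x \<bullet> b))) = (\<Prod>b\<in>Basis. (LINT x|lborel. g b x))"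
    by (subst lborel_eq, subst integral_distr)
      (auto simp: intro!: product_integral_prod g borel_measurable_prod)
qed

lemma fourier_std_normal_density:
  "integrable lborel (\<lambda>x. complex_of_real (std_normal_density x) * exp (\<i> * complex_of_real (t * x)))"
  "(LINT x|lborel. complex_of_real (std_normal_density x) * exp (\<i> * complex_of_real (t * x)))
     = complex_of_real (exp (- t\<^sup>2 / 2))"
proof -
  show "integrable lborel (\<lambda>x. complex_of_real (std_normal_density x) * exp (\<i> * complex_of_real (t * x)))"
    by (rule Bochner_Integration.integrable_bound[OF integrable_normal_density[of 1 0]])
      (auto simp: norm_mult)
  have "char std_normal_distribution t = (LINT x|lborel. std_normal_density x *\<^sub>R iexp (t * x))"
    unfolding char_def by (rule integral_density) auto
  then show "(LINT x|lborel. complex_of_real (std_normal_density x) * exp (\<i> * complex_of_real (t * x)))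
     = complex_of_real (exp (- t\<^sup>2 / 2))"
    by (simp add: char_std_normal_distribution scaleR_conv_of_real)
qed

text \<open>Self-duality of the Gaussian: the transform factorises over the coordinates into
  one-dimensional normal characteristic functions, with product exp(-|x|^2 / 2). Multiplying by
  \<open>std_gauss 0\<close> makes this \<open>std_gauss x\<close> again.\<close>

lemma
  fixes x :: "'a::euclidean_space"
  shows integrable_fourier_std_gauss:
      "integrable lborel (\<lambda>z. complex_of_real (std_gauss z) * exp (\<i> * complex_of_real (z \<bullet> x)))"
    and fourier_std_gauss:
      "std_gauss (0::'a) * (LINT z|lborel. complex_of_real (std_gauss z) * exp (\<i> * complex_of_real (z \<bullet> x)))
        = complex_of_real (std_gauss x)"
proof -
  let ?g = "\<lambda>b y. complex_of_real (std_normal_density y) * exp (\<i> * complex_of_real ((x \<bullet> b) * y))"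
  have *: "complex_of_real (std_gauss z) * exp (\<i> * complex_of_real (z \<bullet> x)) =
      (\<Prod>b\<in>Basis. ?g b (z \<bullet> b))" for z
    by (simp add: std_gauss_def prod.distrib euclidean_inner[of z x] exp_sum sum_distrib_left mult.commute)
  show "integrable lborel (\<lambda>z. complex_of_real (std_gauss z) * exp (\<i> * complex_of_real (z \<bullet> x)))"
    unfolding * by (intro integrable_lborel_prod fourier_std_normal_density)
  have "(\<Sum>b\<in>Basis. - (x \<bullet> b)\<^sup>2 / 2) = - (norm x)\<^sup>2 / 2"
    by (simp add: norm_eq_sqrt_inner euclidean_inner[of x x] power2_eq_square sum_negf
        sum_divide_distrib sum_nonneg)
  moreover have "(\<Prod>b\<in>Basis. complex_of_real (exp (- (x \<bullet> b)\<^sup>2 / 2))) = of_real (exp (\<Sum>b\<in>Basis. - (x \<bullet> b)\<^sup>2 / 2))"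
    by (simp only: exp_sum finite_Basis of_real_prod)
  ultimately have "(LINT z|lborel. complex_of_real (std_gauss z) * exp (\<i> * complex_of_real (z \<bullet> x)))
      = complex_of_real (exp (- (norm x)\<^sup>2 / 2))"
    unfolding * integral_lborel_prod[of ?g, OF fourier_std_normal_density(1)] fourier_std_normal_density
    by simp
  then show "std_gauss (0::'a) * (LINT z|lborel. complex_of_real (std_gauss z) * exp (\<i> * complex_of_real (z \<bullet> x)))
        = complex_of_real (std_gauss x)"
    by (subst std_gauss_eq) (simp only: of_real_mult)
qed

lemma integrable_std_gauss: "integrable lborel (std_gauss :: 'a::euclidean_space \<Rightarrow> real)"
  using integrable_fourier_std_gauss[of "0::'a"] by (simp add: complex_of_real_integrable_eq)

text \<open>Self-duality at the point 0 reads c * integral = c with c = \<open>std_gauss 0\<close> >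
  0, so the total mass comes without a separate computation.\<close>

lemma integral_std_gauss: "(LINT x|lborel. std_gauss (x::'a::euclidean_space)) = 1"
proof -
  have "complex_of_real (std_gauss (0::'a) * (LINT x|lborel. std_gauss (x::'a))) = complex_of_real (std_gauss (0::'a))"
    using fourier_std_gauss[of "0::'a"] by simp
  then show ?thesis using std_gauss_pos[of "0::'a"] by (simp only: of_real_eq_iff) simp
qed

lemma integrable_lborel_affine:
  fixes f :: "'a::euclidean_space \<Rightarrow> 'b::{banach, second_countable_topology}"
  assumes "c \<noteq> 0" "integrable lborel f"
  shows "integrable lborel (\<lambda>x. f (t + c *\<^sub>R x))"
proof -
  have [measurable]: "f \<in> borel_measurable borel" using assms(2) by simp
  have "integrable (density (distr lborel borel (\<lambda>x. t + c *\<^sub>R x)) (\<lambda>_. \<bar>c\<bar>^DIM('a))) f"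
    using lborel_affine[OF assms(1), of t] assms(2) by simp
  then have "integrable lborel (\<lambda>x. \<bar>c\<bar> ^ DIM('a) *\<^sub>R f (t + c *\<^sub>R x))"
    by (subst (asm) integrable_density) (auto simp: integrable_distr_eq)
  from integrable_scaleR_right[OF this, of "inverse (\<bar>c\<bar> ^ DIM('a))"] show ?thesis
    using assms(1) by simp
qed

lemma integral_lborel_affine:
  fixes f :: "'a::euclidean_space \<Rightarrow> 'b::{banach, second_countable_topology}"
  assumes "c \<noteq> 0" and [measurable]: "f \<in> borel_measurable borel"
  shows "(LINT x|lborel. f x) = \<bar>c\<bar> ^ DIM('a) *\<^sub>R (LINT x|lborel. f (t + c *\<^sub>R x))"
proof -
  have "(LINT x|lborel. f x) = (LINT x|density (distr lborel borel (\<lambda>x. t + c *\<^sub>R x)) (\<lambda>_. \<bar>c\<bar>^DIM('a)). f x)"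
    using lborel_affine[OF assms(1), of t] by simp
  also have "\<dots> = (LINT x|lborel. \<bar>c\<bar>^DIM('a) *\<^sub>R f (t + c *\<^sub>R x))"
    by (subst integral_density) (auto simp: integral_distr)
  finally show ?thesis by simp
qed

subsection \<open>Fourier inversion\<close>

text \<open>Since \<open>B\<close> has total mass 1, a bound depending on the first variable alone
  stays integrable on the product. This provides the hypothesis for each exchange of a Lebesgue
  integral with an expectation.\<close>

lemma integrable_pair_dominated:
  fixes f :: "'a \<times> 'b \<Rightarrow> 'c::{banach, second_countable_topology}"
  assumes "sigma_finite_measure A" "prob_space B" "integrable A g"
    and [measurable]: "f \<in> borel_measurable (A \<Otimes>\<^sub>M B)"
    and le: "\<And>x y. norm (f (x, y)) \<le> g x"
  shows "integrable (A \<Otimes>\<^sub>M B) f"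
proof -
  interpret A: sigma_finite_measure A by fact
  interpret B: prob_space B by fact
  interpret pair_sigma_finite A B ..
  have [measurable]: "g \<in> borel_measurable A" using assms by auto
  have "integrable (A \<Otimes>\<^sub>M B) (\<lambda>z. g (fst z))"
    using assms(3) by (intro Fubini_integrable) (auto simp: B.prob_space)
  then show ?thesis
    by (rule Bochner_Integration.integrable_bound) (auto intro!: order_trans[OF le])
qed

text \<open>Indicators of bounded open sets are increasing limits of continuous functions, and open
  boxes form an intersection-stable generator of the Borel sets. Bounded support is required of the
  test functions so that they are Lebesgue integrable where the lemma is applied.\<close>

lemma measure_eqI_continuous:
  fixes \<mu> \<nu> :: "'a::euclidean_space measure"
  assumes sets: "sets \<mu> = sets borel" "sets \<nu> = sets borel"
    and fin: "finite_measure \<mu>"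
    and eq: "\<And>h :: 'a \<Rightarrow> real. continuous_on UNIV h \<Longrightarrow> (\<And>x. 0 \<le> h x) \<Longrightarrow> (\<And>x. h x \<le> 1) \<Longrightarrow>
      bounded {x. h x \<noteq> 0} \<Longrightarrow> (\<integral>\<^sup>+ x. ennreal (h x) \<partial>\<mu>) = (\<integral>\<^sup>+ x. ennreal (h x) \<partial>\<nu>)"
  shows "\<mu> = \<nu>"
proof -
  interpret finite_measure \<mu> by fact
  have [measurable_cong]: "sets \<mu> = sets borel" "sets \<nu> = sets borel" by fact+
  have op: "emeasure \<mu> U = emeasure \<nu> U" if U: "open U" "bounded U" for U
  proof -
    \<comment> \<open>Vanishes off \<open>U\<close> and increases to 1 at each point of
      \<open>U\<close>, because an open set leaves a positive distance to its complement.\<close>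
    define h where "h n x = min 1 (real n * infdist x (- U))" for n x
    \<comment> \<open>The distance to an empty set is 0 by convention, which would make
      \<open>h\<close> vanish identically; boundedness of \<open>U\<close> excludes this.\<close>
    have ne: "- U \<noteq> {}" using U(2) not_bounded_UNIV[where 'a='a] by (metis Compl_empty_eq double_compl)
    have cont: "continuous_on UNIV (h n)" for n
      unfolding h_def by (intro continuous_intros)
    have [measurable]: "h n \<in> borel_measurable borel" for n
      by (intro borel_measurable_continuous_onI cont)
    have out: "h n x = 0" if "x \<notin> U" for n x
      using that by (simp add: h_def)
    have bnd: "0 \<le> h n x" "h n x \<le> 1" for n x
      by (auto simp: h_def infdist_nonneg)
    have "{x. h n x \<noteq> 0} \<subseteq> U" for n using out by auto
    then have bs: "bounded {x. h n x \<noteq> 0}" for n using U(2) bounded_subset by blast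
    have inc: "incseq (\<lambda>n x. ennreal (h n x))"
      unfolding h_def
      by (intro incseq_SucI le_funI ennreal_leI min.mono order_refl mult_right_mono) (auto simp: infdist_nonneg)
    have lim: "(\<lambda>n. ennreal (h n x)) \<longlonglongrightarrow> indicator U x" for x
    proof (cases "x \<in> U")
      case True
      have "closed (- U)" using U(1) by auto
      then have pos: "infdist x (- U) > 0"
        using in_closed_iff_infdist_zero[of "- U" x] ne True infdist_nonneg[of x "- U"] by auto
      obtain N where N: "1 < real N * infdist x (- U)" using reals_Archimedean3[OF pos] by blast
      have "h n x = 1" if "n \<ge> N" for n
      proof -
        have "real N * infdist x (- U) \<le> real n * infdist x (- U)"
          using that pos by (intro mult_right_mono) auto
        with N show ?thesis by (simp add: h_def)
      qed
      then have "eventually (\<lambda>n. ennreal (h n x) = indicator U x) sequentially"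
        using True by (auto simp: eventually_sequentially intro!: exI[of _ N])
      then show ?thesis by (rule tendsto_eventually)
    qed (simp add: out)
    have "(\<lambda>n. \<integral>\<^sup>+ x. h n x \<partial>\<mu>) \<longlonglongrightarrow> (\<integral>\<^sup>+ x. indicator U x \<partial>\<mu>)"
      by (rule nn_integral_LIMSEQ[OF inc _ lim]) measurable
    moreover have "(\<lambda>n. \<integral>\<^sup>+ x. h n x \<partial>\<nu>) \<longlonglongrightarrow> (\<integral>\<^sup>+ x. indicator U x \<partial>\<nu>)"
      by (rule nn_integral_LIMSEQ[OF inc _ lim]) measurable
    moreover have "(\<integral>\<^sup>+ x. h n x \<partial>\<mu>) = (\<integral>\<^sup>+ x. h n x \<partial>\<nu>)" for n
      by (intro eq[of "h n"] cont bnd bs)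
    ultimately have "(\<integral>\<^sup>+ x. indicator U x \<partial>\<mu>) = (\<integral>\<^sup>+ x. indicator U x \<partial>\<nu>)"
      using LIMSEQ_unique by simp
    then show ?thesis using U(1) by (simp add: sets)
  qed
  let ?E = "range (\<lambda>(a, b). box a b :: 'a set)"
  show ?thesis
  proof (rule measure_eqI_generator_eq)
    show "Int_stable ?E"
      by (auto simp: Int_stable_def box_Int_box)
    show "?E \<subseteq> Pow UNIV" "sets \<mu> = sigma_sets UNIV ?E" "sets \<nu> = sigma_sets UNIV ?E"
      by (simp_all add: borel_eq_box sets)
    let ?A = "\<lambda>n::nat. box (- (real n *\<^sub>R One)) (real n *\<^sub>R One) :: 'a set"
    show "range ?A \<subseteq> ?E" "(\<Union>i. ?A i) = UNIV"
      unfolding UN_box_eq_UNIV by auto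
    show "emeasure \<mu> (?A i) \<noteq> \<infinity>" for i by simp
    show "emeasure \<mu> S = emeasure \<nu> S" if "S \<in> ?E" for S
      using that by (auto intro!: op)
  qed
qed

text \<open>Here \<open>(std_gauss 0)\<^sup>2\<close> is the Fourier inversion constant \<open>(2 * pi)\<close> to the power \<open>- DIM('a)\<close>.\<close>

definition inv_density :: "'w measure \<Rightarrow> ('w \<Rightarrow> 'a::euclidean_space) \<Rightarrow> 'a \<Rightarrow> real" where
  "inv_density M X x = (std_gauss (0::'a))\<^sup>2 *
     Re (LINT z|lborel. exp (- \<i> * complex_of_real (z \<bullet> x)) * char_fun M X z)"

text \<open>For \<open>\<sigma> > 0\<close> this is the density of the sum of \<open>X\<close> and an independent centred Gaussian vector
  with covariance \<open>\<sigma>\<^sup>2\<close> times the identity.\<close>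

definition moll_density :: "'w measure \<Rightarrow> ('w \<Rightarrow> 'a::euclidean_space) \<Rightarrow> real \<Rightarrow> 'a \<Rightarrow> real" where
  "moll_density M X \<sigma> x = std_gauss (0::'a) *
     Re (LINT z|lborel. exp (- \<i> * complex_of_real (z \<bullet> x)) * char_fun M X z * complex_of_real (std_gauss (\<sigma> *\<^sub>R z)))"

context
  fixes M :: "'w measure" and X :: "'w \<Rightarrow> 'a::euclidean_space"
  assumes prob: "prob_space M"
    and X [measurable]: "X \<in> borel_measurable M"
    and int: "integrable lborel (char_fun M X)"
begin

interpretation prob_space M by (rule prob)

interpretation lM: pair_sigma_finite "lborel :: 'a measure" M ..

lemma borel_measurable_char_fun [measurable]: "char_fun M X \<in> borel_measurable borel"
  using int by simp

text \<open>Substituting \<sigma> z for z reduces this to self-duality; the power of \<sigma> is the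
  Jacobian. The right-hand side is the density at \<open>v\<close> of a centred Gaussian vector with
  covariance \<sigma>^2 times the identity.\<close>

lemma scaled_fourier_std_gauss:
  fixes v :: 'a
  assumes "0 < \<sigma>"
  shows "std_gauss (0::'a) * (LINT z|lborel. complex_of_real (std_gauss (\<sigma> *\<^sub>R z)) * exp (\<i> * complex_of_real (z \<bullet> v)))
    = complex_of_real (std_gauss ((1 / \<sigma>) *\<^sub>R v) / \<sigma> ^ DIM('a))"
proof -
  have "(LINT z|lborel. complex_of_real (std_gauss z) * exp (\<i> * complex_of_real (z \<bullet> ((1 / \<sigma>) *\<^sub>R v))))
    = \<sigma> ^ DIM('a) * (LINT z|lborel. complex_of_real (std_gauss (\<sigma> *\<^sub>R z)) * exp (\<i> * complex_of_real (z \<bullet> v)))"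
    using assms by (subst integral_lborel_affine[of \<sigma> _ 0]) (auto simp: scaleR_conv_of_real)
  then show ?thesis
    using fourier_std_gauss[of "(1 / \<sigma>) *\<^sub>R v"] assms by (simp add: field_simps)
qed

text \<open>The factor \<open>std_gauss (\<sigma> *\<^sub>R z)\<close> is integrable in
  \<open>z\<close>, so the expectation inside \<open>char_fun\<close> may be pulled out. In the
  resulting form, sign and measurability in \<open>x\<close> are evident.\<close>

lemma moll_density_eq:
  assumes \<sigma>: "0 < \<sigma>"
  shows "moll_density M X \<sigma> x = (LINT \<omega>|M. std_gauss ((1 / \<sigma>) *\<^sub>R (X \<omega> - x)) / \<sigma> ^ DIM('a))"
proof -
  let ?F = "\<lambda>z \<omega>. complex_of_real (std_gauss (\<sigma> *\<^sub>R z)) * exp (\<i> * complex_of_real (z \<bullet> (X \<omega> - x)))"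
  have "integrable (lborel \<Otimes>\<^sub>M M) (case_prod ?F)"
    using integrable_lborel_affine[of \<sigma> std_gauss "0::'a"] \<sigma> integrable_std_gauss
    by (intro integrable_pair_dominated[where g="\<lambda>z. std_gauss (\<sigma> *\<^sub>R z)"])
      (auto simp: norm_mult prob lborel.sigma_finite_measure_axioms)
  note swap = lM.Fubini_integral[OF this]
  have F: "?F z \<omega> = (exp (- \<i> * complex_of_real (z \<bullet> x)) * complex_of_real (std_gauss (\<sigma> *\<^sub>R z))) * exp (\<i> * complex_of_real (z \<bullet> X \<omega>))" for z \<omega>
    by (simp add: inner_diff_right right_diff_distrib exp_diff exp_minus field_simps)
  have "(LINT \<omega>|M. ?F z \<omega>) = exp (- \<i> * complex_of_real (z \<bullet> x)) * complex_of_real (std_gauss (\<sigma> *\<^sub>R z)) * char_fun M X z" for z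
    unfolding F char_fun_def by (rule integral_mult_right_zero)
  then have "(LINT z|lborel. exp (- \<i> * complex_of_real (z \<bullet> x)) * char_fun M X z * complex_of_real (std_gauss (\<sigma> *\<^sub>R z)))
      = (LINT \<omega>|M. LINT z|lborel. ?F z \<omega>)"
    unfolding swap by (simp only: mult_ac)
  then have "moll_density M X \<sigma> x = Re (std_gauss (0::'a) * (LINT \<omega>|M. LINT z|lborel. ?F z \<omega>))"
    unfolding moll_density_def by simp
  also have "std_gauss (0::'a) * (LINT \<omega>|M. LINT z|lborel. ?F z \<omega>) =
      (LINT \<omega>|M. std_gauss (0::'a) * (LINT z|lborel. ?F z \<omega>))"
    by simp
  also have "\<dots> = (LINT \<omega>|M. complex_of_real (std_gauss ((1 / \<sigma>) *\<^sub>R (X \<omega> - x)) / \<sigma> ^ DIM('a)))"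
    unfolding scaled_fourier_std_gauss[OF \<sigma>] ..
  finally show ?thesis by (simp del: of_real_divide)
qed

text \<open>The exponential has modulus 1 and the Gaussian peaks at 0. The bound is free of
  \<sigma>, hence usable as a dominating function when \<sigma> tends to 0.\<close>

lemma norm_integrand_le:
  "norm (exp (- \<i> * complex_of_real (z \<bullet> x)) * char_fun M X z * complex_of_real (std_gauss (y::'a)))
    \<le> std_gauss (0::'a) * norm (char_fun M X z)"
  using mult_right_mono[OF std_gauss_le norm_ge_zero, of y "char_fun M X z"]
  by (simp add: norm_mult mult.commute)

lemma abs_moll_density_le:
  "\<bar>moll_density M X \<sigma> x\<bar> \<le> (std_gauss (0::'a))\<^sup>2 * (LINT z|lborel. norm (char_fun M X z))"
proof -
  let ?c = "std_gauss (0::'a)"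
  let ?g = "\<lambda>z. exp (- \<i> * complex_of_real (z \<bullet> x)) * char_fun M X z * complex_of_real (std_gauss (\<sigma> *\<^sub>R z))"
  have w: "integrable lborel (\<lambda>z. ?c * norm (char_fun M X z))"
    using int by simp
  have "integrable lborel ?g"
    by (rule Bochner_Integration.integrable_bound[OF w])
      (use norm_integrand_le order_trans[OF _ abs_ge_self] in \<open>auto simp del: norm_mult\<close>)
  then have "norm (LINT z|lborel. ?g z) \<le> (LINT z|lborel. ?c * norm (char_fun M X z))"
    by (intro Bochner_Integration.integral_norm_bound_integral w norm_integrand_le)
  then have "?c * \<bar>Re (LINT z|lborel. ?g z)\<bar> \<le> ?c * (?c * (LINT z|lborel. norm (char_fun M X z)))"
    by (intro mult_left_mono order_trans[OF abs_Re_le_cmod]) auto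
  then show ?thesis by (simp add: moll_density_def abs_mult power2_eq_square mult.assoc)
qed

text \<open>As \<sigma> tends to 0 the Gaussian factor flattens to the constant
  \<open>std_gauss 0\<close>; this is the origin of the square in
  \<open>inv_density\<close>.\<close>

lemma moll_density_tendsto:
  "(\<lambda>n. moll_density M X (inverse (real (Suc n))) x) \<longlonglongrightarrow> inv_density M X x"
proof -
  let ?c = "std_gauss (0::'a)"
  let ?g = "\<lambda>z. exp (- \<i> * complex_of_real (z \<bullet> x)) * char_fun M X z"
  have "(\<lambda>n. LINT z|lborel. ?g z * complex_of_real (std_gauss (inverse (real (Suc n)) *\<^sub>R z)))
      \<longlonglongrightarrow> (LINT z|lborel. ?g z * complex_of_real ?c)"
  proof (rule integral_dominated_convergence[where w="\<lambda>z. ?c * norm (char_fun M X z)"])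
    show "AE z in lborel. (\<lambda>n. ?g z * complex_of_real (std_gauss (inverse (real (Suc n)) *\<^sub>R z))) \<longlonglongrightarrow> ?g z * complex_of_real ?c"
    proof (rule AE_I2)
      fix z :: 'a
      have "(\<lambda>n. inverse (real (Suc n)) *\<^sub>R z) \<longlonglongrightarrow> 0 *\<^sub>R z"
        by (intro tendsto_intros LIMSEQ_inverse_real_of_nat)
      moreover have "isCont (std_gauss :: 'a \<Rightarrow> real) 0"
        using continuous_on_std_gauss[OF continuous_on_id, of "UNIV :: 'a set"]
        by (simp add: continuous_on_eq_continuous_at)
      ultimately have "(\<lambda>n. std_gauss (inverse (real (Suc n)) *\<^sub>R z)) \<longlonglongrightarrow> ?c"
        using isCont_tendsto_compose[of "0::'a" std_gauss] by simp
      then show "(\<lambda>n. ?g z * complex_of_real (std_gauss (inverse (real (Suc n)) *\<^sub>R z))) \<longlonglongrightarrow> ?g z * complex_of_real ?c"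
        by (intro tendsto_intros)
    qed
    show "AE z in lborel. norm (?g z * complex_of_real (std_gauss (inverse (real (Suc n)) *\<^sub>R z))) \<le> ?c * norm (char_fun M X z)" for n
      by (intro AE_I2 norm_integrand_le)
  qed (use int in auto)
  then have "(\<lambda>n. ?c * Re (LINT z|lborel. ?g z * complex_of_real (std_gauss (inverse (real (Suc n)) *\<^sub>R z))))
      \<longlonglongrightarrow> ?c * Re (LINT z|lborel. ?g z * complex_of_real ?c)"
    by (intro tendsto_intros)
  then show ?thesis
    by (simp add: moll_density_def inv_density_def power2_eq_square mult_ac)
qed

lemma inv_density_nonneg: "0 \<le> inv_density M X x"
proof (rule LIMSEQ_le_const[OF moll_density_tendsto], intro exI allI impI)
  show "0 \<le> moll_density M X (inverse (real (Suc n))) x" for n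
    by (subst moll_density_eq) (auto intro!: integral_nonneg_AE)
qed

lemma inv_density_le: "inv_density M X x \<le> (std_gauss (0::'a))\<^sup>2 * (LINT z|lborel. norm (char_fun M X z))"
  using abs_moll_density_le
  by (intro LIMSEQ_le_const2[OF moll_density_tendsto] exI allI impI) (meson abs_le_D1)

lemma borel_measurable_moll_density [measurable]: "0 < \<sigma> \<Longrightarrow> moll_density M X \<sigma> \<in> borel_measurable borel"
  by (subst measurable_cong[OF moll_density_eq]) auto

lemma borel_measurable_inv_density [measurable]: "inv_density M X \<in> borel_measurable borel"
  by (rule borel_measurable_LIMSEQ_real[OF moll_density_tendsto]) auto

text \<open>The right-hand side is the expectation of h(X - \<sigma> G) with G standard Gaussian and
  independent of X, written as an iterated integral.\<close>

lemma integral_moll_density: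
  fixes h :: "'a \<Rightarrow> real"
  assumes \<sigma>: "0 < \<sigma>" and h: "integrable lborel h"
  shows "(LINT x|lborel. h x * moll_density M X \<sigma> x) = (LINT \<omega>|M. LINT y|lborel. h (X \<omega> - \<sigma> *\<^sub>R y) * std_gauss y)"
proof -
  have [measurable]: "h \<in> borel_measurable borel" using h by simp
  let ?F = "\<lambda>x \<omega>. h x * (std_gauss ((1 / \<sigma>) *\<^sub>R (X \<omega> - x)) / \<sigma> ^ DIM('a))"
  have "integrable (lborel \<Otimes>\<^sub>M M) (case_prod ?F)"
    using h \<sigma> std_gauss_le
    by (intro integrable_pair_dominated[where g="\<lambda>x. \<bar>h x\<bar> * (std_gauss (0::'a) / \<sigma> ^ DIM('a))"])
      (auto simp: abs_mult prob lborel.sigma_finite_measure_axioms intro!: mult_left_mono divide_right_mono)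
  note swap = lM.Fubini_integral[OF this]
  have "(LINT x|lborel. h x * moll_density M X \<sigma> x) = (LINT x|lborel. LINT \<omega>|M. ?F x \<omega>)"
    unfolding moll_density_eq[OF \<sigma>] by simp
  also have "\<dots> = (LINT \<omega>|M. LINT x|lborel. ?F x \<omega>)" by (rule swap[symmetric])
  also have "(\<lambda>\<omega>. LINT x|lborel. ?F x \<omega>) = (\<lambda>\<omega>. LINT y|lborel. h (X \<omega> - \<sigma> *\<^sub>R y) * std_gauss y)"
  proof
    show "(LINT x|lborel. ?F x \<omega>) = (LINT y|lborel. h (X \<omega> - \<sigma> *\<^sub>R y) * std_gauss y)" for \<omega>
      \<comment> \<open>Substitution x = X \<omega> - \<sigma> y; its Jacobian cancels the power of
        \<sigma> in the kernel.\<close>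
      using \<sigma> by (subst integral_lborel_affine[of "- \<sigma>" _ "X \<omega>"]) auto
  qed
  finally show ?thesis .
qed

text \<open>Both sides are limits of the same sequence, the integral of \<open>h\<close> against the
  smoothed density. On the density side the uniform bound \<open>?K\<close> and integrability of
  \<open>h\<close> dominate; on the side of the random vector, continuity and boundedness of
  \<open>h\<close> suffice.\<close>

lemma expectation_eq_integral_inv_density:
  fixes h :: "'a \<Rightarrow> real"
  assumes h: "continuous_on UNIV h" "\<And>x. \<bar>h x\<bar> \<le> 1" "integrable lborel h"
  shows "(LINT \<omega>|M. h (X \<omega>)) = (LINT x|lborel. h x * inv_density M X x)"
proof (rule LIMSEQ_unique)
  have [measurable]: "h \<in> borel_measurable borel" using h by simp
  let ?s = "\<lambda>n. inverse (real (Suc n))"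
  let ?K = "(std_gauss (0::'a))\<^sup>2 * (LINT z|lborel. norm (char_fun M X z))"
  show "(\<lambda>n. LINT x|lborel. h x * moll_density M X (?s n) x) \<longlonglongrightarrow> (LINT x|lborel. h x * inv_density M X x)"
  proof (rule integral_dominated_convergence[where w="\<lambda>x. \<bar>h x\<bar> * ?K"])
    show "AE x in lborel. (\<lambda>n. h x * moll_density M X (?s n) x) \<longlonglongrightarrow> h x * inv_density M X x"
      by (intro AE_I2 tendsto_intros moll_density_tendsto)
    show "AE x in lborel. norm (h x * moll_density M X (?s n) x) \<le> \<bar>h x\<bar> * ?K" for n
      by (intro AE_I2) (auto simp: abs_mult intro!: mult_left_mono abs_moll_density_le)
  qed (use h in auto)
  have "(\<lambda>n. LINT \<omega>|M. LINT y|lborel. h (X \<omega> - ?s n *\<^sub>R y) * std_gauss y) \<longlonglongrightarrow> (LINT \<omega>|M. h (X \<omega>))"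
  proof (rule integral_dominated_convergence[where w="\<lambda>_. 1"])
    show "AE \<omega> in M. (\<lambda>n. LINT y|lborel. h (X \<omega> - ?s n *\<^sub>R y) * std_gauss y) \<longlonglongrightarrow> h (X \<omega>)"
    proof (rule AE_I2)
      fix \<omega>
      have "(\<lambda>n. LINT y|lborel. h (X \<omega> - ?s n *\<^sub>R y) * std_gauss y) \<longlonglongrightarrow> (LINT y|lborel. h (X \<omega>) * std_gauss (y::'a))"
      proof (rule integral_dominated_convergence[where w=std_gauss])
        show "AE y in lborel. (\<lambda>n. h (X \<omega> - ?s n *\<^sub>R y) * std_gauss y) \<longlonglongrightarrow> h (X \<omega>) * std_gauss y"
        proof (rule AE_I2)
          fix y :: 'a
          have "(\<lambda>n. X \<omega> - ?s n *\<^sub>R y) \<longlonglongrightarrow> X \<omega> - 0 *\<^sub>R y"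
            by (intro tendsto_intros LIMSEQ_inverse_real_of_nat)
          moreover have "isCont h (X \<omega>)" using h(1) by (simp add: continuous_on_eq_continuous_at)
          ultimately have "(\<lambda>n. h (X \<omega> - ?s n *\<^sub>R y)) \<longlonglongrightarrow> h (X \<omega>)"
            using isCont_tendsto_compose[of "X \<omega>" h] by simp
          then show "(\<lambda>n. h (X \<omega> - ?s n *\<^sub>R y) * std_gauss y) \<longlonglongrightarrow> h (X \<omega>) * std_gauss y"
            by (intro tendsto_intros)
        qed
        show "AE y in lborel. norm (h (X \<omega> - ?s n *\<^sub>R y) * std_gauss y) \<le> std_gauss y" for n
          using h(2) by (auto simp: abs_mult intro!: mult_left_le_one_le)
      qed (use integrable_std_gauss in auto)
      then show "(\<lambda>n. LINT y|lborel. h (X \<omega> - ?s n *\<^sub>R y) * std_gauss y) \<longlonglongrightarrow> h (X \<omega>)"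
        by (simp add: integral_std_gauss)
    qed
    show "AE \<omega> in M. norm (LINT y|lborel. h (X \<omega> - ?s n *\<^sub>R y) * std_gauss y) \<le> 1" for n
    proof (rule AE_I2)
      fix \<omega>
      have "norm (LINT y|lborel. h (X \<omega> - ?s n *\<^sub>R y) * std_gauss y) \<le> (LINT y|lborel. std_gauss (y::'a))"
        using h(2)
        by (intro Bochner_Integration.integral_norm_bound_integral integrable_std_gauss
            Bochner_Integration.integrable_bound[OF integrable_std_gauss])
          (auto simp: abs_mult intro!: mult_left_le_one_le)
      then show "norm (LINT y|lborel. h (X \<omega> - ?s n *\<^sub>R y) * std_gauss y) \<le> 1"
        by (simp add: integral_std_gauss)
    qed
  qed auto
  then show "(\<lambda>n. LINT x|lborel. h x * moll_density M X (?s n) x) \<longlonglongrightarrow> (LINT \<omega>|M. h (X \<omega>))"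
    using h(3) by (simp add: integral_moll_density)
qed

lemma distr_eq_inv_density: "distr M borel X = density lborel (inv_density M X)"
proof (rule measure_eqI_continuous)
  show "finite_measure (distr M borel X)"
    by (intro prob_space.finite_measure prob_space_distr) simp
  fix h :: "'a \<Rightarrow> real"
  assume h: "continuous_on UNIV h" "\<And>x. 0 \<le> h x" "\<And>x. h x \<le> 1" "bounded {x. h x \<noteq> 0}"
  have [measurable]: "h \<in> borel_measurable borel" using h by (simp add: borel_measurable_continuous_onI)
  obtain R where R: "\<And>x. h x \<noteq> 0 \<Longrightarrow> norm x \<le> R" using h(4) unfolding bounded_iff by auto
  have "integrable lborel (indicator (cball (0::'a) R) :: 'a \<Rightarrow> real)"
    using emeasure_lborel_cball_finite[of "0::'a" R] by (simp add: integrable_indicator_iff)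
  then have hi: "integrable lborel h"
  proof (rule Bochner_Integration.integrable_bound)
    show "AE x in lborel. norm (h x) \<le> norm (indicator (cball (0::'a) R) x :: real)"
    proof (rule AE_I2)
      fix x
      show "norm (h x) \<le> norm (indicator (cball (0::'a) R) x :: real)"
        using R[of x] h(2,3)[of x] by (cases "h x = 0") auto
    qed
  qed simp
  \<comment> \<open>Integrability of \<open>inv_density\<close> is not yet known at this point; its
    uniform bound makes the product with \<open>h\<close> integrable.\<close>
  let ?K = "(std_gauss (0::'a))\<^sup>2 * (LINT z|lborel. norm (char_fun M X z))"
  have hf: "integrable lborel (\<lambda>x. h x * inv_density M X x)"
    by (rule Bochner_Integration.integrable_bound[of _ "\<lambda>x. h x * ?K"])
      (use hi h inv_density_nonneg inv_density_le in
        \<open>auto simp: abs_mult intro!: AE_I2 mult_left_mono order_trans[OF inv_density_le]\<close>)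
  have "(\<integral>\<^sup>+ x. h x \<partial>distr M borel X) = (\<integral>\<^sup>+ \<omega>. h (X \<omega>) \<partial>M)"
    by (simp add: nn_integral_distr)
  also have "\<dots> = ennreal (LINT \<omega>|M. h (X \<omega>))"
    using h by (intro nn_integral_eq_integral integrable_const_bound[of _ 1]) auto
  also have "\<dots> = ennreal (LINT x|lborel. h x * inv_density M X x)"
    using h hi by (subst expectation_eq_integral_inv_density) auto
  also have "\<dots> = (\<integral>\<^sup>+ x. h x * inv_density M X x \<partial>lborel)"
    using h hf inv_density_nonneg by (intro nn_integral_eq_integral[symmetric]) auto
  also have "\<dots> = (\<integral>\<^sup>+ x. h x \<partial>density lborel (inv_density M X))"
    using h inv_density_nonneg by (simp add: nn_integral_density ennreal_mult mult.commute)
  finally show "(\<integral>\<^sup>+ x. h x \<partial>distr M borel X) = (\<integral>\<^sup>+ x. h x \<partial>density lborel (inv_density M X))" .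
qed auto

text \<open>Total mass 1 is inherited from the law of \<open>X\<close>, with no integral of the
  Fourier formula to compute.\<close>

lemma prob_space_inv_density: "prob_space (density lborel (inv_density M X))"
  using prob_space_distr[of X borel] by (simp add: distr_eq_inv_density)

lemma integrable_inv_density: "integrable lborel (inv_density M X)"
  using prob_space.emeasure_space_1[OF prob_space_inv_density] inv_density_nonneg
  by (intro integrableI_nonneg) (auto simp: emeasure_density)

end

subsection \<open>Coupling of densities\<close>

text \<open>Used to glue the diagonal and the off-diagonal part of a coupling.\<close>

lemma sum_of_measures:
  assumes "sets A = sets B"
  obtains N where "sets N = sets A" "\<And>S. S \<in> sets A \<Longrightarrow> emeasure N S = emeasure A S + emeasure B S"
proof
  let ?k = "\<lambda>S. emeasure A S + emeasure B S"
  let ?N = "measure_of (space A) (sets A) ?k"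
  show s: "sets ?N = sets A" by simp
  show "emeasure ?N S = ?k S" if "S \<in> sets A" for S
  proof (rule emeasure_measure_of[OF refl])
    show "sets A \<subseteq> Pow (space A)" by (rule sets.space_closed)
    show "positive (sets ?N) ?k" by (simp add: positive_def)
    show "countably_additive (sets ?N) ?k"
      unfolding s by (intro countably_additiveI)
        (simp add: suminf_emeasure[symmetric] assms[symmetric] suminf_add[symmetric])
    show "S \<in> sets ?N" using that by simp
  qed
qed

lemma tv_dist_densities:
  fixes f g :: "'a::euclidean_space \<Rightarrow> real"
  assumes f: "prob_space (density lborel f)" "integrable lborel f" "\<And>x. 0 \<le> f x"
    and g: "prob_space (density lborel g)" "integrable lborel g" "\<And>x. 0 \<le> g x"
  shows "0 \<le> tv_dist (density lborel f) (density lborel g)"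
    and "tv_dist (density lborel f) (density lborel g) \<le> (LINT x|lborel. max 0 (g x - f x))"
proof -
  have [measurable]: "f \<in> borel_measurable borel" "g \<in> borel_measurable borel"
    using f g by auto
  define \<mu> where "\<mu> = density lborel f"
  define \<nu> where "\<nu> = density lborel g"
  define a where "a = (LINT x|lborel. max 0 (f x - g x))"
  have ints: "integrable lborel (\<lambda>x. max 0 (f x - g x))" "integrable lborel (\<lambda>x. max 0 (g x - f x))"
    using f g by (auto intro!: integrable_max)
  have one: "(LINT x|lborel. f x) = 1" "(LINT x|lborel. g x) = 1"
    using prob_space.emeasure_space_1[OF f(1)] prob_space.emeasure_space_1[OF g(1)] f g
    by (auto simp: emeasure_density nn_integral_eq_integral)
  \<comment> \<open>The two residuals have equal mass since max 0 t - max 0 (-t) = t and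
    \<open>f\<close>, \<open>g\<close> both integrate to 1. Hence either residual may appear in the
    final bound.\<close>
  have "a - (LINT x|lborel. max 0 (g x - f x)) = (LINT x|lborel. max 0 (f x - g x) - max 0 (g x - f x))"
    unfolding a_def by (intro Bochner_Integration.integral_diff[symmetric] ints)
  also have "\<dots> = (LINT x|lborel. f x - g x)" by (intro Bochner_Integration.integral_cong) auto
  also have "\<dots> = 0" using f g one by simp
  finally have a': "a = (LINT x|lborel. max 0 (g x - f x))" by simp
  have a0: "0 \<le> a" unfolding a_def by (intro integral_nonneg_AE) auto
  \<comment> \<open>Maximal coupling: the common part of the densities sits on the diagonal (measure \<open>E\<close>), the two
    residuals are coupled independently (measure \<open>Q\<close>). If \<open>a = 0\<close>, the junk value \<open>1 / a = 0\<close> makes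
    \<open>Q\<close> vanish, as it should.\<close>
  define R where "R = density lborel (\<lambda>x. max 0 (f x - g x))"
  define S where "S = density lborel (\<lambda>x. max 0 (g x - f x))"
  define D where "D = density lborel (\<lambda>x. min (f x) (g x))"
  have [simp]: "sets R = sets borel" "sets S = sets borel" "sets D = sets borel" 
    "sets \<mu> = sets borel" "sets \<nu> = sets borel"
    "space R = UNIV" "space S = UNIV" "space D = UNIV" "space \<mu> = UNIV" "space \<nu> = UNIV"
    by (auto simp: R_def S_def D_def \<mu>_def \<nu>_def)
  have [simp]: "emeasure R UNIV = a" "emeasure S UNIV = a"
    unfolding R_def S_def using nn_integral_eq_integral[OF ints(1)] nn_integral_eq_integral[OF ints(2)]
    by (simp_all add: emeasure_density a_def a'[unfolded a_def])
  interpret R: finite_measure R by standard simp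
  interpret S: finite_measure S by standard simp
  interpret RS: pair_sigma_finite R S ..
  define Q where "Q = scale_measure (ennreal (1 / a)) (R \<Otimes>\<^sub>M S)"
  define E where "E = distr D (borel \<Otimes>\<^sub>M borel) (\<lambda>x. (x, x))"
  have sE: "sets E = sets (borel \<Otimes>\<^sub>M borel)" by (simp add: E_def)
  have sRS: "sets (R \<Otimes>\<^sub>M S) = sets (borel \<Otimes>\<^sub>M borel)" by (intro sets_pair_measure_cong) auto
  have sQ: "sets Q = sets (borel \<Otimes>\<^sub>M borel)" by (simp add: Q_def sRS)
  have small: "emeasure R A = 0" "emeasure S A = 0" if "a = 0" for A
    using emeasure_space[of R A] emeasure_space[of S A] that by auto
  \<comment> \<open>A marginal of the product of the residuals carries the total mass
    \<open>a\<close> of the other factor, which 1 / a removes. For \<open>a = 0\<close> the side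
    condition holds because both residuals are null.\<close>
  have scal: "ennreal (1 / a) * (x * ennreal a) = x" if "a = 0 \<Longrightarrow> x = 0" for x
    using that a0 by (cases "a = 0") (auto simp: mult.left_commute[of _ x] ennreal_mult[symmetric])
  have Q1: "emeasure Q (A \<times> UNIV) = emeasure R A" if "A \<in> sets borel" for A
    using that small scal[of "emeasure R A"] by (simp add: Q_def S.emeasure_pair_measure_Times)
  have Q2: "emeasure Q (UNIV \<times> A) = emeasure S A" if "A \<in> sets borel" for A
    using that small scal[of "emeasure S A"] by (simp add: Q_def S.emeasure_pair_measure_Times mult.commute)
  obtain P where P: "sets P = sets (borel \<Otimes>\<^sub>M borel)"
      "\<And>A. A \<in> sets (borel \<Otimes>\<^sub>M borel) \<Longrightarrow> emeasure P A = emeasure E A + emeasure Q A"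
    using sum_of_measures[of E Q] sE sQ by metis
  have [simp]: "space P = UNIV" using sets_eq_imp_space_eq[OF P(1)] by (simp add: space_pair_measure)
  have "(\<lambda>x. (x, x)) \<in> D \<rightarrow>\<^sub>M borel \<Otimes>\<^sub>M borel"
    unfolding D_def by measurable
  then have Em: "emeasure E A = emeasure D {x. (x, x) \<in> A}" if "A \<in> sets (borel \<Otimes>\<^sub>M borel)" for A
    using that by (simp add: E_def emeasure_distr vimage_def)
  have E1: "emeasure E (A \<times> UNIV) = emeasure D A" "emeasure E (UNIV \<times> A) = emeasure D A" if "A \<in> sets borel" for A
    using that by (auto simp: Em)
  \<comment> \<open>\<open>ennreal\<close> sends negative reals to 0, so
    \<open>ennreal (x - y)\<close> already is the positive part.\<close>
  have mm: "ennreal (min x y) + ennreal (x - y) = ennreal x" if "0 \<le> x" "0 \<le> y" for x y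
    using that by (cases "x \<le> y")
      (auto simp: ennreal_neg min_def ennreal_plus[symmetric] simp del: ennreal_plus)
  have DR: "emeasure D A + emeasure R A = emeasure \<mu> A" if [measurable]: "A \<in> sets borel" for A
    unfolding D_def R_def \<mu>_def using f g
    by (auto simp: emeasure_density nn_integral_add[symmetric] distrib_right[symmetric] mm
        intro!: nn_integral_cong)
  have DS: "emeasure D A + emeasure S A = emeasure \<nu> A" if [measurable]: "A \<in> sets borel" for A
    unfolding D_def S_def \<nu>_def using f g
    by (auto simp: emeasure_density nn_integral_add[symmetric] distrib_right[symmetric] mm
        min.commute[of "f _"] intro!: nn_integral_cong)
  have P1: "emeasure P (A \<times> UNIV) = emeasure \<mu> A" "emeasure P (UNIV \<times> A) = emeasure \<nu> A" if "A \<in> sets borel" for A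
    using that by (auto simp: P E1 Q1 Q2 DR DS)
  have [measurable_cong]: "sets P = sets (borel \<Otimes>\<^sub>M borel)" by (rule P)
  have d1: "distr P \<mu> fst = \<mu>"
  proof (rule measure_eqI)
    fix A assume "A \<in> sets (distr P \<mu> fst)"
    then have [measurable]: "A \<in> sets borel" by simp
    have "fst -` A = A \<times> (UNIV :: 'a set)" by auto
    moreover have "fst \<in> P \<rightarrow>\<^sub>M \<mu>"
      by (subst measurable_cong_sets[OF P(1), of \<mu> borel]) auto
    ultimately show "emeasure (distr P \<mu> fst) A = emeasure \<mu> A"
      by (subst emeasure_distr) (auto simp: P1)
  qed simp
  have d2: "distr P \<nu> snd = \<nu>"
  proof (rule measure_eqI)
    fix A assume "A \<in> sets (distr P \<nu> snd)"
    then have [measurable]: "A \<in> sets borel" by simp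
    have "snd -` A = (UNIV :: 'a set) \<times> A" by auto
    moreover have "snd \<in> P \<rightarrow>\<^sub>M \<nu>"
      by (subst measurable_cong_sets[OF P(1), of \<nu> borel]) auto
    ultimately show "emeasure (distr P \<nu> snd) A = emeasure \<nu> A"
      by (subst emeasure_distr) (auto simp: P1)
  qed simp
  have "prob_space P"
    using P1(1)[of UNIV] prob_space.emeasure_space_1[OF f(1)]
    by (intro prob_spaceI) (simp add: \<mu>_def)
  then have Pc: "P \<in> couplings \<mu> \<nu>"
    using d1 d2 P(1) sets_pair_measure_cong[of \<mu> borel \<nu> borel] by (auto simp: couplings_def)
  have "{(u, v). u \<noteq> v} \<in> sets (borel :: ('a \<times> 'a) measure)"
    by (intro borel_open) (auto simp: case_prod_unfold intro!: open_Collect_neq continuous_intros)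
  then have off: "{(u, v). u \<noteq> v} \<in> sets (borel \<Otimes>\<^sub>M borel :: ('a \<times> 'a) measure)"
    unfolding borel_prod .
  \<comment> \<open>\<open>E\<close> is carried by the diagonal, so only \<open>Q\<close>, of total
    mass \<open>a\<close>, contributes.\<close>
  have "emeasure P {(u, v). u \<noteq> v} = emeasure Q {(u, v). u \<noteq> v}"
    using off by (simp add: P Em)
  also have "\<dots> \<le> emeasure Q (UNIV \<times> UNIV)"
    using sets.top[of "borel \<Otimes>\<^sub>M borel :: ('a \<times> 'a) measure"]
    by (intro emeasure_mono) (auto simp: sQ space_pair_measure)
  also have "\<dots> = a" by (subst Q1) auto
  finally have "measure P {(u, v). u \<noteq> v} \<le> a"
    using a0 by (simp add: measure_def enn2real_leI)
  moreover have "tv_dist \<mu> \<nu> \<le> measure P {(u, v). u \<noteq> v}"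
    unfolding tv_dist_def by (intro cINF_lower Pc bdd_belowI[of _ 0]) auto
  ultimately show "tv_dist (density lborel f) (density lborel g) \<le> (LINT x|lborel. max 0 (g x - f x))"
    by (simp add: \<mu>_def \<nu>_def a')
  \<comment> \<open>A lower bound on the infimum requires a nonempty set of couplings;
    \<open>P\<close> is the witness.\<close>
  have "0 \<le> tv_dist \<mu> \<nu>"
    unfolding tv_dist_def using Pc by (intro cINF_greatest) auto
  then show "0 \<le> tv_dist (density lborel f) (density lborel g)" by (simp add: \<mu>_def \<nu>_def)
qed

subsection \<open>Convergence\<close>

lemma norm_char_fun_le:
  assumes "prob_space M"
  shows "norm (char_fun M X z) \<le> 1"
proof -
  interpret prob_space M by fact
  show ?thesis
    unfolding char_fun_def
    by (rule order_trans[OF integral_norm_bound]) (simp add: prob_space)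
qed

text \<open>Convergence in distribution is tested on real functions only, so the exponential is
  split into cosine and sine, both bounded and continuous.\<close>

lemma char_fun_tendsto:
  fixes X :: "nat \<Rightarrow> 'w \<Rightarrow> 'a::euclidean_space"
  assumes "prob_space M" and X: "\<And>n. X n \<in> borel_measurable M" and Y: "Y \<in> borel_measurable M"
    and conv: "converges_in_distribution M X Y sequentially"
  shows "(\<lambda>n. char_fun M (X n) z) \<longlonglongrightarrow> char_fun M Y z"
proof -
  interpret prob_space M by fact
  have eq: "char_fun M Z z = Complex (LINT \<omega>|M. cos (z \<bullet> Z \<omega>)) (LINT \<omega>|M. sin (z \<bullet> Z \<omega>))"
    if [measurable]: "Z \<in> borel_measurable M" for Z :: "'w \<Rightarrow> 'a"
  proof -
    have "integrable M (\<lambda>\<omega>. exp (\<i> * complex_of_real (z \<bullet> Z \<omega>)))"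
      by (rule integrable_const_bound[of _ 1]) auto
    from integral_Re[OF this] integral_Im[OF this] show ?thesis
      by (simp add: char_fun_def complex_eq_iff Re_exp Im_exp)
  qed
  have bounded: "bounded (range (\<lambda>x. cos (z \<bullet> x)))" "bounded (range (\<lambda>x. sin (z \<bullet> x)))"
    by (auto intro!: boundedI[of _ 1])
  have "(\<lambda>n. LINT \<omega>|M. cos (z \<bullet> X n \<omega>)) \<longlonglongrightarrow> (LINT \<omega>|M. cos (z \<bullet> Y \<omega>))"
    "(\<lambda>n. LINT \<omega>|M. sin (z \<bullet> X n \<omega>)) \<longlonglongrightarrow> (LINT \<omega>|M. sin (z \<bullet> Y \<omega>))"
    using conv[unfolded converges_in_distribution_def, rule_format, of "\<lambda>x. cos (z \<bullet> x)"]
      conv[unfolded converges_in_distribution_def, rule_format, of "\<lambda>x. sin (z \<bullet> x)"]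
    by (simp_all add: continuous_intros bounded)
  then show ?thesis
    unfolding eq[OF X] eq[OF Y] by (intro tendsto_Complex)
qed

lemma char_fun_tendsto_L1:
  fixes X :: "nat \<Rightarrow> 'w \<Rightarrow> 'a::euclidean_space"
  assumes "prob_space M" and X: "\<And>n. X n \<in> borel_measurable M" and Y: "Y \<in> borel_measurable M"
    and conv: "converges_in_distribution M X Y sequentially"
    and iY: "integrable lborel (char_fun M Y)"
    and iX: "\<And>n. integrable lborel (char_fun M (X n))"
    and tail: "\<And>e::real. 0 < e \<Longrightarrow> \<exists>l. eventually (\<lambda>n.
        (\<integral>\<^sup>+ z \<in> {z. norm z \<ge> l}. ennreal (norm (char_fun M (X n) z)) \<partial>lborel) < ennreal e) sequentially"
  shows "(\<lambda>n. LINT z|lborel. norm (char_fun M (X n) z - char_fun M Y z)) \<longlonglongrightarrow> 0"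
proof (rule LIMSEQ_I)
  fix e :: real assume e: "0 < e"
  let ?\<phi> = "\<lambda>n. char_fun M (X n)" and ?\<psi> = "char_fun M Y"
  have [measurable]: "?\<psi> \<in> borel_measurable borel" "?\<phi> n \<in> borel_measurable borel" for n
    using iY iX[of n] by auto
  \<comment> \<open>Dominated convergence gives the limit on balls only; outside, both tails are small by themselves.\<close>
  obtain l where l: "eventually (\<lambda>n. (\<integral>\<^sup>+ z \<in> {z. norm z \<ge> l}. ennreal (norm (?\<phi> n z)) \<partial>lborel) < ennreal (e / 3)) sequentially"
    using tail[of "e / 3"] e by auto
  \<comment> \<open>The tail of the limit vanishes because \<psi> itself is integrable; the
    hypothesis \<open>tail\<close> speaks only of the approximating functions.\<close>
  have "(\<lambda>k. LINT z|lborel. norm (?\<psi> z) * indicator {z. norm z \<ge> real k} z) \<longlonglongrightarrow> (LINT z::'a|lborel. (0 :: real))"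
  proof (rule integral_dominated_convergence[where w="\<lambda>z. norm (?\<psi> z)"])
    show "AE z in lborel. (\<lambda>k. norm (?\<psi> z) * indicator {z. norm z \<ge> real k} z) \<longlonglongrightarrow> 0"
    proof (rule AE_I2)
      fix z :: 'a
      obtain K where K: "norm z < real K" using reals_Archimedean2 by blast
      then have "eventually (\<lambda>k. norm (?\<psi> z) * indicator {z. norm z \<ge> real k} z = 0) sequentially"
        by (auto simp: eventually_sequentially intro!: exI[of _ K])
      then show "(\<lambda>k. norm (?\<psi> z) * indicator {z. norm z \<ge> real k} z) \<longlonglongrightarrow> 0"
        by (rule tendsto_eventually)
    qed
  qed (use iY in \<open>auto split: split_indicator\<close>)
  then have "eventually (\<lambda>k. (LINT z|lborel. norm (?\<psi> z) * indicator {z. norm z \<ge> real k} z) < e / 3) sequentially"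
    using e by (intro order_tendstoD(2)[of _ "0::real"]) auto
  moreover have "eventually (\<lambda>k. l \<le> real k) sequentially"
    using filterlim_real_sequentially by (simp add: filterlim_at_top)
  \<comment> \<open>One radius for both tails: enlarging it beyond \<open>l\<close> only shrinks the
    region covered by \<open>tail\<close>.\<close>
  ultimately obtain k where k: "(LINT z|lborel. norm (?\<psi> z) * indicator {z. norm z \<ge> real k} z) < e / 3" "l \<le> real k"
    using eventually_happens[OF eventually_conj] sequentially_bot by blast
  let ?B = "ball (0::'a) (real k)" and ?C = "{z::'a. norm z \<ge> real k}"
  have iB: "integrable lborel (\<lambda>z::'a. 2 * indicator ?B z :: real)"
    using emeasure_lborel_ball_finite[of "0::'a" "real k"] by (simp add: integrable_indicator_iff)
  have [measurable]: "?B \<in> sets borel" by simp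
  have le2: "norm (?\<phi> n z - ?\<psi> z) \<le> 2" for n z
    using norm_triangle_ineq4[of "?\<phi> n z" "?\<psi> z"] norm_char_fun_le[OF assms(1), of "X n" z]
      norm_char_fun_le[OF assms(1), of Y z] by simp
  have "(\<lambda>n. LINT z|lborel. norm (?\<phi> n z - ?\<psi> z) * indicator ?B z) \<longlonglongrightarrow> (LINT z::'a|lborel. (0 :: real))"
  proof (rule integral_dominated_convergence[OF _ _ iB])
    show "AE z in lborel. (\<lambda>n. norm (?\<phi> n z - ?\<psi> z) * indicator ?B z) \<longlonglongrightarrow> 0"
      using char_fun_tendsto[OF assms(1-4)]
      by (intro AE_I2 tendsto_mult_left_zero tendsto_norm_zero) (simp add: LIM_zero)
    show "AE z in lborel. norm (norm (?\<phi> n z - ?\<psi> z) * indicator ?B z) \<le> 2 * indicator ?B z" for n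
      using le2 by (auto split: split_indicator)
  qed auto
  then have "eventually (\<lambda>n. (LINT z|lborel. norm (?\<phi> n z - ?\<psi> z) * indicator ?B z) < e / 3) sequentially"
    using e by (intro order_tendstoD(2)[of _ "0::real"]) auto
  with l have "eventually (\<lambda>n. norm ((LINT z|lborel. norm (?\<phi> n z - ?\<psi> z)) - 0) < e) sequentially"
  proof eventually_elim
    fix n
    assume n1: "(\<integral>\<^sup>+ z \<in> {z. norm z \<ge> l}. ennreal (norm (?\<phi> n z)) \<partial>lborel) < ennreal (e / 3)"
      and n2: "(LINT z|lborel. norm (?\<phi> n z - ?\<psi> z) * indicator ?B z) < e / 3"
    have ii: "integrable lborel (\<lambda>z. norm (?\<phi> n z - ?\<psi> z))"
      "integrable lborel (\<lambda>z. norm (?\<phi> n z - ?\<psi> z) * indicator ?B z)"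
      "integrable lborel (\<lambda>z. norm (?\<phi> n z) * indicator ?C z)"
      "integrable lborel (\<lambda>z. norm (?\<psi> z) * indicator ?C z)"
      using iX[of n] iY by (auto intro!: integrable_real_mult_indicator)
    have "ennreal (LINT z|lborel. norm (?\<phi> n z) * indicator ?C z) = (\<integral>\<^sup>+ z. norm (?\<phi> n z) * indicator ?C z \<partial>lborel)"
      by (intro nn_integral_eq_integral[symmetric] ii) auto
    also have "\<dots> \<le> (\<integral>\<^sup>+ z \<in> {z. norm z \<ge> l}. ennreal (norm (?\<phi> n z)) \<partial>lborel)"
      using k(2) by (intro nn_integral_mono) (auto split: split_indicator)
    also note n1
    finally have n3: "(LINT z|lborel. norm (?\<phi> n z) * indicator ?C z) < e / 3"
      by (subst (asm) ennreal_less_iff) (auto intro!: integral_nonneg_AE)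
    have "(LINT z|lborel. norm (?\<phi> n z - ?\<psi> z)) \<le> (LINT z|lborel. norm (?\<phi> n z - ?\<psi> z) * indicator ?B z
        + (norm (?\<phi> n z) * indicator ?C z + norm (?\<psi> z) * indicator ?C z))"
      using ii norm_triangle_ineq4 by (intro integral_mono) (auto split: split_indicator)
    also have "\<dots> = (LINT z|lborel. norm (?\<phi> n z - ?\<psi> z) * indicator ?B z)
        + ((LINT z|lborel. norm (?\<phi> n z) * indicator ?C z) + (LINT z|lborel. norm (?\<psi> z) * indicator ?C z))"
      using ii by simp
    also have "\<dots> < e" using n2 n3 k(1) by simp
    finally show "norm ((LINT z|lborel. norm (?\<phi> n z - ?\<psi> z)) - 0) < e" by simp
  qed
  then show "\<exists>no. \<forall>n\<ge>no. norm ((LINT z|lborel. norm (?\<phi> n z - ?\<psi> z)) - 0) < e"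
    by (simp add: eventually_sequentially)
qed

text \<open>The kernel has modulus 1, so the bound does not depend on \<open>x\<close>: L^1
  closeness in frequency gives uniform closeness of densities.\<close>

lemma inv_density_diff_le:
  fixes X Y :: "'w \<Rightarrow> 'a::euclidean_space"
  assumes iX: "integrable lborel (char_fun M X)" and iY: "integrable lborel (char_fun M Y)"
  shows "\<bar>inv_density M X x - inv_density M Y x\<bar>
    \<le> (std_gauss (0::'a))\<^sup>2 * (LINT z|lborel. norm (char_fun M X z - char_fun M Y z))"
proof -
  let ?e = "\<lambda>z. exp (- \<i> * complex_of_real (z \<bullet> x))"
  have int: "integrable lborel (\<lambda>z. ?e z * char_fun M Z z)" if "integrable lborel (char_fun M Z)" for Z :: "'w \<Rightarrow> 'a"
    using that by (rule Bochner_Integration.integrable_bound) (use that in \<open>auto simp: norm_mult\<close>)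
  have "inv_density M X x - inv_density M Y x =
      (std_gauss (0::'a))\<^sup>2 * Re (LINT z|lborel. ?e z * (char_fun M X z - char_fun M Y z))"
    unfolding inv_density_def right_diff_distrib using int[OF iX] int[OF iY]
    by (simp add: right_diff_distrib)
  also have "\<bar>\<dots>\<bar> \<le> (std_gauss (0::'a))\<^sup>2 * norm (LINT z|lborel. ?e z * (char_fun M X z - char_fun M Y z))"
    by (simp add: abs_mult abs_Re_le_cmod mult_left_mono)
  also have "norm (LINT z|lborel. ?e z * (char_fun M X z - char_fun M Y z)) \<le> (LINT z|lborel. norm (char_fun M X z - char_fun M Y z))"
    by (rule order_trans[OF integral_norm_bound]) (simp add: norm_mult)
  finally show ?thesis by (simp add: mult_left_mono)
qed

lemma tv_dist_tendsto_sequentially: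
  fixes X :: "nat \<Rightarrow> 'w \<Rightarrow> 'a::euclidean_space"
  assumes prob: "prob_space M" and X: "\<And>n. X n \<in> borel_measurable M" and Y: "Y \<in> borel_measurable M"
    and conv: "converges_in_distribution M X Y sequentially"
    and iY: "integrable lborel (char_fun M Y)"
    and iX: "\<And>n. integrable lborel (char_fun M (X n))"
    and tail: "\<And>e::real. 0 < e \<Longrightarrow> \<exists>l. eventually (\<lambda>n.
        (\<integral>\<^sup>+ z \<in> {z. norm z \<ge> l}. ennreal (norm (char_fun M (X n) z)) \<partial>lborel) < ennreal e) sequentially"
  shows "(\<lambda>n. tv_dist (distr M borel (X n)) (distr M borel Y)) \<longlonglongrightarrow> 0"
proof -
  let ?f = "\<lambda>n. inv_density M (X n)" and ?g = "inv_density M Y"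
  note dX = prob_space_inv_density[OF prob X iX] integrable_inv_density[OF prob X iX] inv_density_nonneg[OF prob X iX]
  note dY = prob_space_inv_density[OF prob Y iY] integrable_inv_density[OF prob Y iY] inv_density_nonneg[OF prob Y iY]
  have tv: "0 \<le> tv_dist (distr M borel (X n)) (distr M borel Y)"
    "tv_dist (distr M borel (X n)) (distr M borel Y) \<le> (LINT x|lborel. max 0 (?g x - ?f n x))" for n
    unfolding distr_eq_inv_density[OF prob X iX] distr_eq_inv_density[OF prob Y iY]
    by (intro tv_dist_densities dX dY)+
  have "(\<lambda>n. (std_gauss (0::'a))\<^sup>2 * (LINT z|lborel. norm (char_fun M (X n) z - char_fun M Y z))) \<longlonglongrightarrow> 0"
    by (intro tendsto_mult_right_zero char_fun_tendsto_L1 assms)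
  then have "(\<lambda>n. ?f n x - ?g x) \<longlonglongrightarrow> 0" for x
    by (rule Lim_null_comparison[rotated]) (auto intro!: always_eventually inv_density_diff_le iX iY)
  then have lim: "(\<lambda>n. ?f n x) \<longlonglongrightarrow> ?g x" for x by (rule LIM_zero_cancel)
  have "(\<lambda>n. LINT x|lborel. max 0 (?g x - ?f n x)) \<longlonglongrightarrow> (LINT x::'a|lborel. (0::real))"
  proof (rule integral_dominated_convergence[OF _ _ dY(2)])
    show "AE x in lborel. (\<lambda>n. max 0 (?g x - ?f n x)) \<longlonglongrightarrow> 0"
    proof (rule AE_I2)
      fix x
      have "(\<lambda>n. max 0 (?g x - ?f n x)) \<longlonglongrightarrow> max 0 (?g x - ?g x)"
        by (intro tendsto_intros lim)
      then show "(\<lambda>n. max 0 (?g x - ?f n x)) \<longlonglongrightarrow> 0" by simp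
    qed
    \<comment> \<open>Nonnegativity of \<open>?f n\<close> is what keeps the positive part below
      \<open>?g\<close>.\<close>
    show "AE x in lborel. norm (max 0 (?g x - ?f n x)) \<le> ?g x" for n
      using dX(3)[of n] dY(3) by (auto simp: max_def)
    show "(\<lambda>x. max 0 (?g x - ?f n x)) \<in> borel_measurable lborel" for n
      using borel_measurable_integrable[OF dX(2)] borel_measurable_integrable[OF dY(2)] by measurable
  qed auto
  then have gap: "(\<lambda>n. LINT x|lborel. max 0 (?g x - ?f n x)) \<longlonglongrightarrow> 0" by simp
  show ?thesis
    by (rule tendsto_sandwich[OF _ _ tendsto_const gap]) (simp_all add: tv)
qed

theorem propositionA3:
  fixes M :: "'w measure"
    and X :: "real \<Rightarrow> 'w \<Rightarrow> real ^ 'd"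
    and Y :: "'w \<Rightarrow> real ^ 'd"
  assumes "prob_space M"
    and "\<And>\<epsilon>. \<epsilon> > 0 \<Longrightarrow> X \<epsilon> \<in> borel_measurable M"
    and "Y \<in> borel_measurable M"
    and "converges_in_distribution M X Y (at_right 0)"
    and "integrable lborel (char_fun M Y)"
    and "\<And>\<epsilon>. \<epsilon> > 0 \<Longrightarrow> integrable lborel (char_fun M (X \<epsilon>))"
    and "Limsup at_top (\<lambda>l::real. Limsup (at_right 0) (\<lambda>\<epsilon>.
           \<integral>\<^sup>+ z \<in> {z. norm z \<ge> l}. ennreal (norm (char_fun M (X \<epsilon>) z)) \<partial>lborel)) = 0"
  shows "((\<lambda>\<epsilon>. tv_dist (distr M borel (X \<epsilon>)) (distr M borel Y)) \<longlongrightarrow> 0) (at_right 0)"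
  unfolding tendsto_at_iff_sequentially comp_def
proof (intro allI impI)
  fix s :: "nat \<Rightarrow> real"
  assume s: "\<forall>i. s i \<in> {0<..} - {0}" "s \<longlonglongrightarrow> 0"
  then have pos: "0 < s n" for n by auto
  \<comment> \<open>Positivity of the sequence places it in the filter \<open>at_right 0\<close>, so
    each hypothesis along \<epsilon> transfers by composition.\<close>
  have lim: "filterlim s (at_right 0) sequentially"
    using s(2) pos pos[THEN less_imp_neq, symmetric] by (simp add: filterlim_at)
  show "(\<lambda>n. tv_dist (distr M borel (X (s n))) (distr M borel Y)) \<longlonglongrightarrow> 0"
  proof (rule tv_dist_tendsto_sequentially)
    show "converges_in_distribution M (\<lambda>n. X (s n)) Y sequentially"
      unfolding converges_in_distribution_def
    proof (intro allI impI)
      fix f :: "real ^ 'd \<Rightarrow> real"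
      assume "continuous_on UNIV f \<and> bounded (range f)"
      then have "((\<lambda>\<epsilon>. LINT \<omega>|M. f (X \<epsilon> \<omega>)) \<longlongrightarrow> (LINT \<omega>|M. f (Y \<omega>))) (at_right 0)"
        using assms(4) by (simp add: converges_in_distribution_def)
      then show "(\<lambda>n. LINT \<omega>|M. f (X (s n) \<omega>)) \<longlonglongrightarrow> (LINT \<omega>|M. f (Y \<omega>))"
        by (rule filterlim_compose[OF _ lim])
    qed
    fix e :: real assume "0 < e"
    \<comment> \<open>An outer limsup equal to 0 puts the inner limsup below \<open>e\<close> for
      all large \<open>l\<close>; a single such \<open>l\<close> is enough.\<close>
    then have "eventually (\<lambda>l::real. Limsup (at_right 0) (\<lambda>\<epsilon>.
        \<integral>\<^sup>+ z \<in> {z. norm z \<ge> l}. ennreal (norm (char_fun M (X \<epsilon>) z)) \<partial>lborel) < ennreal e) at_top"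
      by (intro Limsup_lessD) (simp add: assms(7))
    then obtain l where "Limsup (at_right 0) (\<lambda>\<epsilon>.
        \<integral>\<^sup>+ z \<in> {z. norm z \<ge> l}. ennreal (norm (char_fun M (X \<epsilon>) z)) \<partial>lborel) < ennreal e"
      using eventually_happens trivial_limit_at_top_linorder by blast
    from Limsup_lessD[OF this]
    show "\<exists>l. eventually (\<lambda>n. (\<integral>\<^sup>+ z \<in> {z. norm z \<ge> l}. ennreal (norm (char_fun M (X (s n)) z)) \<partial>lborel) < ennreal e) sequentially"
      by (intro exI[of _ l] eventually_compose_filterlim[OF _ lim])
  qed (use assms pos in auto)
qed

end
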